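(* In the setting described in the context, let $X=H$ be a Hilbert space with inner product $(\cdot,\cdot)_H$, let $\mu,\nu\in[0,1)$, $\mathsf c_\mu\in\Phi_{h,\mu}(\mathsf c)$, $\mathsf a_\nu\in\Phi_{h,\nu}(\mathsf a)$, $b_\nu\in\Upsilon_{h,\nu}(b)$, let $\mathsf P_{h,\mu}:=\mathsf M_h^{-1}\mathsf C_{h,\mu}\mathsf N_h^{-1}$, and assume that $$\frac{\gamma_{\mathsf C_\mu}\gamma_{\mathsf A_\nu}}{\|\mathsf m\|\|\mathsf n\|}\le\mathcal V_H(\mathsf P_{h,\mu}\mathsf A_{h,\nu})\quad\text{and}\quad\frac{\gamma_{\mathsf M}\gamma_{\mathsf N}}{\|\mathsf c_\mu\|\|\mathsf a_\nu\|}\le\mathcal V_H((\mathsf P_{h,\mu}\mathsf A_{h,\nu})^{-1}).$$ Consider weighted and Euclidean GMRES$(m)$ applied to $\mathbf P_\mu\mathbf A_\nu\mathbf u_\nu=\mathbf P_\mu\mathbf b_\nu$ with $\mathbf P_\mu:=\mathbf M^{-1}\mathbf C_\mu\mathbf N^{-1}$. Then, for all $1\le k,m\le N$, $$\Theta_k^{(m)}\le\left(1-\frac1{K_{\star,\mu,\nu}}\right)^{1/2}\quad\text{and}\quad\widetilde\Theta_k^{(m)}\le K_{\Lambda_h}\left(1-\frac1{K_{\star,\mu,\nu}}\right)^{1/2},$$ where $$K_{\star,\mu,\nu}:=\frac{\|\mathsf m\|\|\mathsf n\|\|\mathsf c\|\|\mathsf a\|}{\gamma_{\mathsf M}\gamma_{\mathsf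 N}\gamma_{\mathsf C}\gamma_{\mathsf A}}\left(\frac{1+\mu}{1-\mu}\right)\left(\frac{1+\nu}{1-\nu}\right).$$
   Context: Setting. $X=H$ is a complex Hilbert space with norm $\|\cdot\|_X=\|\cdot\|_H=\sqrt{(\cdot,\cdot)_H}$, and $Y,V,W$ are complex reflexive Banach spaces. $\mathsf a$ on $X\times Y$, $\mathsf c$ on $V\times W$, $\mathsf n$ on $V\times Y$ and $\mathsf m$ on $X\times W$ are bounded sesquilinear forms (linear in the first, antilinear in the second argument), with norms $\|\mathsf a\|=\sup_{x\ne0,y\ne0}|\mathsf a(x,y)|/(\|x\|_X\|y\|_Y)$, and similarly $\|\mathsf c\|,\|\mathsf n\|,\|\mathsf m\|$. A prime denotes the space of bounded antilinear functionals; $b\in Y'$. It is assumed that for every $b\in Y'$ there is a unique $u\in X$ with $\mathsf a(u,v)=b(v)$ for all $v\in Y$. For a fixed index $h>0$, $X_h\subset X$, $Y_h\subset Y$, $V_h\subset V$, $W_h\subset W$ are subspaces of the same finite dimension $N$. Discrete inf-sup conditions: there is $\gamma_{\mathsf A}>0$ with $\sup_{v_h\in Y_h\setminus\{0\}}|\mathsf a(u_h,v_h)|/\|v_h\|_Y\ge\gamma_{\mathsf A}\|u_h\|_X$ for all $u_h\in X_h$; likewise $\mathsf c$ on $V_h\times W_h$, $\mathsf n$ on $V_h\times Y_h$, $\mathsf m$ on $X_h\times W_h$ satisfy the analogous condition (supremum over the second argument) with constants $\gamma_{\mathsf C},\gamma_{\mathsf N},\gamma_{\mathsf M}>0$. Perturbations: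 $\mathsf a_\nu\in\Phi_{h,\nu}(\mathsf a)$ means that $\mathsf a_\nu$ is a bounded sesquilinear form on $X\times Y$ with $\gamma_{\mathsf A}^{-1}|\mathsf a(u_h,v_h)-\mathsf a_\nu(u_h,v_h)|\le\nu\|u_h\|_X\|v_h\|_Y$ for all $u_h\in X_h,v_h\in Y_h$; $\mathsf c_\mu\in\Phi_{h,\mu}(\mathsf c)$ means $\mathsf c_\mu$ is a bounded sesquilinear form on $V\times W$ with $\gamma_{\mathsf C}^{-1}|\mathsf c(v_h,w_h)-\mathsf c_\mu(v_h,w_h)|\le\mu\|v_h\|_V\|w_h\|_W$ for all $v_h\in V_h,w_h\in W_h$; $b_\nu\in\Upsilon_{h,\nu}(b)$ means $b_\nu\in Y'$ with $|b(v_h)-b_\nu(v_h)|\le\nu\|b_h\|_{Y_h'}\|v_h\|_Y$ for all $v_h\in Y_h$, where $\|b_h\|_{Y_h'}=\sup_{v_h\in Y_h\setminus\{0\}}|b(v_h)|/\|v_h\|_Y$. The constants $\gamma_{\mathsf A_\nu}>0$ and $\|\mathsf a_\nu\|$ denote a discrete inf-sup constant and a continuity constant of $\mathsf a_\nu$ on $X_h\times Y_h$ with $\gamma_{\mathsf A_\nu}\ge(1-\nu)\gamma_{\mathsf A}$ and $\|\mathsf a_\nu\|\le(1+\nu)\|\mathsf a\|$ (such constants exist); similarly $\gamma_{\mathsf C_\mu}\ge(1-\mu)\gamma_{\mathsf C}$ and $\|\mathsf c_\mu\|\le(1+\mu)\|\mathsf c\|$ for $\mathsf c_\mu$ on $V_h\times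 W_h$. Discrete operators: $\mathsf A_{h,\nu}:X_h\to Y_h'$, $\langle\mathsf A_{h,\nu}u_h,v_h\rangle=\mathsf a_\nu(u_h,v_h)$; analogously $\mathsf C_{h,\mu}:V_h\to W_h'$ (from $\mathsf c_\mu$), $\mathsf N_h:V_h\to Y_h'$, $\mathsf M_h:X_h\to W_h'$. For $\mathsf Q_h:X_h\to X_h$ linear, $\mathcal V_H(\mathsf Q_h)=\inf_{u_h\in X_h\setminus\{0\}}|(\mathsf Q_hu_h,u_h)_H|/(u_h,u_h)_H$. Matrices: given bases $\{\varphi_i\}$ of $X_h$, $\{\phi_i\}$ of $Y_h$, $\{\psi_i\}$ of $V_h$, $\{\xi_i\}$ of $W_h$, $\mathbf A_\nu=(\mathsf a_\nu(\varphi_j,\phi_i))_{i,j}$, $\mathbf C_\mu=(\mathsf c_\mu(\psi_j,\xi_i))_{i,j}$, $\mathbf N=(\mathsf n(\psi_j,\phi_i))_{i,j}$, $\mathbf M=(\mathsf m(\varphi_j,\xi_i))_{i,j}$, $\mathbf b_\nu=(b_\nu(\phi_i))_i$. The Gram matrix $\mathbf H=((\varphi_j,\varphi_i)_H)_{i,j}$ defines $(\mathbf u,\mathbf v)_H=(\mathbf H\mathbf u,\mathbf v)_2$ and $\|\mathbf u\|_H=\sqrt{(\mathbf u,\mathbf u)_H}$ on $\mathbb C^N$. Synthesis operator: $\Lambda_h:\mathbb C^N\to X_h$, $\mathbf u=(u_i)\mapsto u_h=\sum_iu_i\varphi_i$; $\gamma_{\Lambda_h}=\inf_{u_h\ne0}\|u_h\|_X/\|\mathbf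 u\|_2$, $\|\Lambda_h\|=\sup_{u_h\ne0}\|u_h\|_X/\|\mathbf u\|_2$, $K_{\Lambda_h}=\|\Lambda_h\|/\gamma_{\Lambda_h}$. GMRES$(m)$: for a nonsingular $\mathbf Q\in\mathbb C^{N\times N}$, $\mathbf d\in\mathbb C^N$ and initial guess $\mathbf x_0$ not equal to the solution, weighted GMRES$(m)$ for $\mathbf Q\mathbf x=\mathbf d$ produces iterates as follows: for $k=im+t$ with $i\ge0$, $1\le t\le m$, $\mathbf x_k$ is the unique minimizer of $\|\mathbf d-\mathbf Q\mathbf x\|_H$ over $\mathbf x\in\mathbf x_{im}+\mathcal K^t(\mathbf Q,\mathbf d-\mathbf Q\mathbf x_{im})$, where $\mathcal K^t(\mathbf Q,\mathbf r)=\mathrm{span}\{\mathbf Q^j\mathbf r:0\le j\le t-1\}$. Euclidean GMRES$(m)$ produces $\tilde{\mathbf x}_k$ in the same way with $\|\cdot\|_2$ instead of $\|\cdot\|_H$ and $\tilde{\mathbf x}_0=\mathbf x_0$. Here $\mathbf Q=\mathbf P_\mu\mathbf A_\nu$, $\mathbf d=\mathbf P_\mu\mathbf b_\nu$, $\mathbf r_k=\mathbf b_\nu-\mathbf A_\nu\mathbf x_k$, $\tilde{\mathbf r}_k=\mathbf b_\nu-\mathbf A_\nu\tilde{\mathbf x}_k$, and $$\Theta_k^{(m)}=\left(\frac{\|\mathbf P_\mu\mathbf r_k\|_H}{\|\mathbf P_\mu\mathbf r_0\|_H}\right)^{1/k},\qquad\widetilde\Theta_k^{(m)}=\left(\frac{\|\mathbf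 P_\mu\tilde{\mathbf r}_k\|_2}{\|\mathbf P_\mu\mathbf r_0\|_2}\right)^{1/k}.$$ *)

theory Defs
  imports "HOL-Analysis.Analysis"
begin

section \<open>Complex normed, Banach and Hilbert spaces\<close>

class complex_vector = real_vector +
  fixes scaleC :: "complex \<Rightarrow> 'a \<Rightarrow> 'a"  (infixr \<open>*\<^sub>C\<close> 75)
  assumes scaleC_add_right: "c *\<^sub>C (x + y) = c *\<^sub>C x + c *\<^sub>C y"
    and scaleC_add_left: "(c + d) *\<^sub>C x = c *\<^sub>C x + d *\<^sub>C x"
    and scaleC_scaleC: "c *\<^sub>C (d *\<^sub>C x) = (c * d) *\<^sub>C x"
    and scaleR_scaleC: "scaleR r x = complex_of_real r *\<^sub>C x"

class complex_normed_vector = complex_vector + real_normed_vector +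
  assumes norm_scaleC: "norm (c *\<^sub>C x) = cmod c * norm x"

class complex_banach = complex_normed_vector + banach

text \<open>The inner product is linear in the first and antilinear in the second argument.
  Positive definiteness is part of the axiom that ties it to the norm.\<close>

class complex_inner = complex_normed_vector +
  fixes cinner :: "'a \<Rightarrow> 'a \<Rightarrow> complex"
  assumes cinner_add_left: "cinner (x + y) z = cinner x z + cinner y z"
    and cinner_scaleC_left: "cinner (c *\<^sub>C x) y = c * cinner x y"
    and cinner_commute: "cinner x y = cnj (cinner y x)"
    and cinner_self: "cinner x x = complex_of_real ((norm x)\<^sup>2)"

class complex_hilbert = complex_inner + complex_banach

global_interpretation complex_vector: vector_space "scaleC :: complex \<Rightarrow> 'a \<Rightarrow> 'a::complex_vector"
proof
  show "1 *\<^sub>C x = x" for x :: 'a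
    using scaleR_scaleC[of 1 x] by simp
qed (simp_all add: scaleC_add_right scaleC_add_left scaleC_scaleC)

instantiation complex :: complex_hilbert
begin

definition "scaleC c x = c * (x::complex)"
definition "cinner x y = (x::complex) * cnj y"

instance
  by standard
    (simp_all add: scaleC_complex_def cinner_complex_def algebra_simps scaleR_conv_of_real
      norm_mult flip: complex_norm_square)

end

section \<open>Antilinear functionals, reflexivity and sesquilinear forms\<close>

definition bounded_antilinear :: "('a::complex_normed_vector \<Rightarrow> complex) \<Rightarrow> bool" where
  "bounded_antilinear f \<longleftrightarrow>
     (\<forall>x y. f (x + y) = f x + f y) \<and>
     (\<forall>c x. f (c *\<^sub>C x) = cnj c * f x) \<and>
     (\<exists>K. \<forall>x. cmod (f x) \<le> K * norm x)"

definition antidual :: "('a::complex_normed_vector \<Rightarrow> complex) set" where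
  "antidual = {f. bounded_antilinear f}"

text \<open>Every bounded antilinear functional on the antidual (normed by the operator norm) is the
  evaluation at some point; the conjugate makes the evaluation antilinear in the functional.\<close>

definition reflexive_space :: "'a::complex_normed_vector itself \<Rightarrow> bool" where
  "reflexive_space T \<longleftrightarrow>
     (\<forall>F :: ('a \<Rightarrow> complex) \<Rightarrow> complex.
        (\<forall>f\<in>antidual. \<forall>g\<in>antidual. F (\<lambda>x. f x + g x) = F f + F g) \<and>
        (\<forall>c. \<forall>f\<in>antidual. F (\<lambda>x. c * f x) = cnj c * F f) \<and>
        (\<exists>K. \<forall>f\<in>antidual. cmod (F f) \<le> K * onorm f)
        \<longrightarrow> (\<exists>x. \<forall>f\<in>antidual. F f = cnj (f x)))"

definition bounded_sesquilinear ::
  "('a::complex_normed_vector \<Rightarrow> 'b::complex_normed_vector \<Rightarrow> complex) \<Rightarrow> bool" where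
  "bounded_sesquilinear s \<longleftrightarrow>
     (\<forall>x x' y. s (x + x') y = s x y + s x' y) \<and>
     (\<forall>c x y. s (c *\<^sub>C x) y = c * s x y) \<and>
     (\<forall>x y y'. s x (y + y') = s x y + s x y') \<and>
     (\<forall>c x y. s x (c *\<^sub>C y) = cnj c * s x y) \<and>
     (\<exists>K. \<forall>x y. cmod (s x y) \<le> K * norm x * norm y)"

definition form_norm ::
  "('a::complex_normed_vector \<Rightarrow> 'b::complex_normed_vector \<Rightarrow> complex) \<Rightarrow> real" where
  "form_norm s = (SUP (x, y)\<in>{(x, y). x \<noteq> 0 \<and> y \<noteq> 0}. cmod (s x y) / (norm x * norm y))"

section \<open>Discrete inf-sup conditions and perturbations\<close>

definition discrete_inf_sup ::
  "'a set \<Rightarrow> 'b set \<Rightarrow> ('a::complex_normed_vector \<Rightarrow> 'b::complex_normed_vector \<Rightarrow> complex) \<Rightarrow> real \<Rightarrow> bool"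
where
  "discrete_inf_sup S T s \<gamma> \<longleftrightarrow>
     \<gamma> > 0 \<and> (\<forall>u\<in>S. (SUP v\<in>T - {0}. cmod (s u v) / norm v) \<ge> \<gamma> * norm u)"

definition discrete_continuity ::
  "'a set \<Rightarrow> 'b set \<Rightarrow> ('a::complex_normed_vector \<Rightarrow> 'b::complex_normed_vector \<Rightarrow> complex) \<Rightarrow> real \<Rightarrow> bool"
where
  "discrete_continuity S T s C \<longleftrightarrow>
     (\<forall>u\<in>S. \<forall>v\<in>T. cmod (s u v) \<le> C * norm u * norm v)"

text \<open>The argument \<open>\<gamma>\<close> is the discrete inf-sup constant of the unperturbed form \<open>s\<close>.\<close>

definition form_perturbations ::
  "'a set \<Rightarrow> 'b set \<Rightarrow> real \<Rightarrow> real \<Rightarrow> ('a::complex_normed_vector \<Rightarrow> 'b::complex_normed_vector \<Rightarrow> complex)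
    \<Rightarrow> ('a \<Rightarrow> 'b \<Rightarrow> complex) set"
where
  "form_perturbations S T \<gamma> \<nu> s =
     {s'. bounded_sesquilinear s' \<and>
          (\<forall>u\<in>S. \<forall>v\<in>T. inverse \<gamma> * cmod (s u v - s' u v) \<le> \<nu> * norm u * norm v)}"

definition discrete_dual_norm :: "'b::complex_normed_vector set \<Rightarrow> ('b \<Rightarrow> complex) \<Rightarrow> real" where
  "discrete_dual_norm T b = (SUP v\<in>T - {0}. cmod (b v) / norm v)"

definition rhs_perturbations ::
  "'b::complex_normed_vector set \<Rightarrow> real \<Rightarrow> ('b \<Rightarrow> complex) \<Rightarrow> ('b \<Rightarrow> complex) set" where
  "rhs_perturbations T \<nu> b =
     {b' \<in> antidual. \<forall>v\<in>T. cmod (b v - b' v) \<le> \<nu> * discrete_dual_norm T b * norm v}"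

section \<open>Discrete operators\<close>

text \<open>The operator induced by \<open>s\<close> sends \<open>u\<close> to a functional on the subspace \<open>T\<close>. Functionals on
  \<open>T\<close> are represented extensionally, so that two of them are equal iff
  they agree on \<open>T\<close>, and the operator is invertible iff it is so as a map into the antidual of
  \<open>T\<close>.\<close>

definition discrete_op :: "'b set \<Rightarrow> ('a \<Rightarrow> 'b \<Rightarrow> complex) \<Rightarrow> 'a \<Rightarrow> 'b \<Rightarrow> complex" where
  "discrete_op T s u = restrict (s u) T"

definition num_range_dist :: "'x::complex_inner set \<Rightarrow> ('x \<Rightarrow> 'x) \<Rightarrow> real" where
  "num_range_dist S Q = (INF u\<in>S - {0}. cmod (cinner (Q u) u) / Re (cinner u u))"

section \<open>Bases, matrices and the synthesis operator\<close>

definition is_basis :: "('n \<Rightarrow> 'a::complex_vector) \<Rightarrow> 'a set \<Rightarrow> bool" where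
  "is_basis \<phi> S \<longleftrightarrow>
     inj \<phi> \<and> \<not> complex_vector.dependent (range \<phi>) \<and> complex_vector.span (range \<phi>) = S"

definition form_matrix ::
  "('a \<Rightarrow> 'b \<Rightarrow> complex) \<Rightarrow> ('n \<Rightarrow> 'a) \<Rightarrow> ('n \<Rightarrow> 'b) \<Rightarrow> complex ^ 'n ^ 'n" where
  "form_matrix s \<phi> \<psi> = (\<chi> i j. s (\<phi> j) (\<psi> i))"

definition rhs_vector :: "('b \<Rightarrow> complex) \<Rightarrow> ('n \<Rightarrow> 'b) \<Rightarrow> complex ^ 'n" where
  "rhs_vector b \<phi> = (\<chi> i. b (\<phi> i))"

definition dot2 :: "complex ^ 'n \<Rightarrow> complex ^ 'n \<Rightarrow> complex" where
  "dot2 u v = (\<Sum>i\<in>UNIV. u $ i * cnj (v $ i))"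

definition weighted_norm :: "complex ^ 'n ^ 'n \<Rightarrow> complex ^ 'n \<Rightarrow> real" where
  "weighted_norm H u = sqrt (Re (dot2 (H *v u) u))"

definition synthesis :: "('n \<Rightarrow> 'a::complex_vector) \<Rightarrow> complex ^ 'n \<Rightarrow> 'a" where
  "synthesis \<phi> u = (\<Sum>i\<in>UNIV. (u $ i) *\<^sub>C \<phi> i)"

definition synthesis_lower :: "('n::finite \<Rightarrow> 'a::complex_normed_vector) \<Rightarrow> real" where
  "synthesis_lower \<phi> = (INF u\<in>{u. synthesis \<phi> u \<noteq> 0}. norm (synthesis \<phi> u) / norm u)"

definition synthesis_norm :: "('n::finite \<Rightarrow> 'a::complex_normed_vector) \<Rightarrow> real" where
  "synthesis_norm \<phi> = (SUP u\<in>{u. synthesis \<phi> u \<noteq> 0}. norm (synthesis \<phi> u) / norm u)"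

definition synthesis_cond :: "('n::finite \<Rightarrow> 'a::complex_normed_vector) \<Rightarrow> real" where
  "synthesis_cond \<phi> = synthesis_norm \<phi> / synthesis_lower \<phi>"

section \<open>Restarted GMRES\<close>

definition krylov :: "nat \<Rightarrow> complex ^ 'n ^ 'n \<Rightarrow> complex ^ 'n \<Rightarrow> (complex ^ 'n) set" where
  "krylov t Q r = vec.span {(((*v) Q) ^^ j) r | j. j < t}"

text \<open>\<open>x\<close> is the sequence of iterates of GMRES with restart length \<open>m\<close> for \<open>Q x = d\<close> from the
  initial guess \<open>x0\<close>, where residuals are measured in the norm \<open>nrm\<close>. For nonsingular \<open>Q\<close> and a norm
  induced by an inner product the minimizers exist and are unique, so that \<open>x\<close> is determined.\<close>

definition gmres_iterates ::
  "nat \<Rightarrow> (complex ^ 'n \<Rightarrow> real) \<Rightarrow> complex ^ 'n ^ 'n \<Rightarrow> complex ^ 'n \<Rightarrow> complex ^ 'n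
    \<Rightarrow> (nat \<Rightarrow> complex ^ 'n) \<Rightarrow> bool"
where
  "gmres_iterates m nrm Q d x0 x \<longleftrightarrow>
     x 0 = x0 \<and>
     (\<forall>i t. 1 \<le> t \<and> t \<le> m \<longrightarrow>
        is_arg_min (\<lambda>z. nrm (d - Q *v z))
          (\<lambda>z. z \<in> (+) (x (i * m)) ` krylov t Q (d - Q *v x (i * m)))
          (x (i * m + t)))"

end

theory Submission
  imports Defs
begin

text \<open>The matrix \<open>Q = P A\<close> represents the operator \<open>P\<^sub>h A\<^sub>h\<close> in the basis of \<open>X\<^sub>h\<close>, and the weighted
  norm of a coordinate vector is the norm of the element it represents. One step
  \<open>r \<mapsto> r - \<alpha> Q r\<close> with the optimal \<open>\<alpha>\<close> (which depends on \<open>r\<close>) reduces the squared norm by the factor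
  \<open>1 - (|(Q r, r)| / (r, r)) (|(r, Q r)| / (Q r, Q r))\<close>, in which the second
  quotient is a numerical range quotient of the inverse of \<open>Q\<close> at \<open>Q r\<close>. Hence \<open>t\<close> such steps, which
  compete with GMRES in the Krylov space of dimension \<open>t\<close>, reduce the norm by the \<open>t\<close>-th
  power of \<open>(1 - 1 / K)\<^sup>\<onehalf>\<close>. In the Euclidean norm every restart cycle costs a
  factor \<open>K\<^sub>\<Lambda> \<ge> 1\<close>, and there are at most \<open>k\<close> cycles up to step \<open>k\<close>.\<close>

section \<open>Sesquilinear forms and coordinates\<close>

lemma sesquilinear_sum:
  assumes "bounded_sesquilinear s"
  shows sesquilinear_sum_left: "s (\<Sum>i\<in>I. u i *\<^sub>C x i) y = (\<Sum>i\<in>I. u i * s (x i) y)"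
    and sesquilinear_sum_right: "s z (\<Sum>i\<in>I. u i *\<^sub>C y' i) = (\<Sum>i\<in>I. cnj (u i) * s z (y' i))"
proof -
  have add: "\<And>x x' y. s (x + x') y = s x y + s x' y" "\<And>x y y'. s x (y + y') = s x y + s x y'"
    and scale: "\<And>c x y. s (c *\<^sub>C x) y = c * s x y" "\<And>c x y. s x (c *\<^sub>C y) = cnj c * s x y"
    using assms by (auto simp: bounded_sesquilinear_def)
  have zero: "s 0 y = 0" "s z 0 = 0" for y z
    using add(1)[of 0 0 y] add(2)[of z 0 0] by auto
  show "s (\<Sum>i\<in>I. u i *\<^sub>C x i) y = (\<Sum>i\<in>I. u i * s (x i) y)"
    by (induction I rule: infinite_finite_induct) (auto simp: zero add scale)
  show "s z (\<Sum>i\<in>I. u i *\<^sub>C y' i) = (\<Sum>i\<in>I. cnj (u i) * s z (y' i))"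
    by (induction I rule: infinite_finite_induct) (auto simp: zero add scale)
qed

lemma sesquilinear_zero:
  assumes "bounded_sesquilinear s"
  shows "s 0 y = 0" "s z 0 = 0"
  using sesquilinear_sum_left[OF assms, where I = "{}"] sesquilinear_sum_right[OF assms, where I = "{}"]
  by auto

lemma cinner_add_right: "cinner x (y + z) = cinner x y + cinner x z"
  by (metis cinner_add_left cinner_commute complex_cnj_add)

lemma cinner_scaleC_right: "cinner x (c *\<^sub>C y) = cnj c * cinner x y"
  by (metis cinner_scaleC_left cinner_commute complex_cnj_mult)

lemma cinner_zero: "cinner 0 y = 0" "cinner x 0 = 0"
  using cinner_add_left[of 0 0 y] cinner_add_right[of x 0 0] by auto

lemma cinner_sum_left: "cinner (\<Sum>i\<in>I. x i) y = (\<Sum>i\<in>I. cinner (x i) y)"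
  by (induction I rule: infinite_finite_induct) (auto simp: cinner_zero cinner_add_left)

lemma cinner_sum_right: "cinner x (\<Sum>i\<in>I. y i) = (\<Sum>i\<in>I. cinner x (y i))"
  by (induction I rule: infinite_finite_induct) (auto simp: cinner_zero cinner_add_right)

text \<open>Rows belong to the test basis and columns to the trial basis, so applying the matrix to
  coordinates tests the represented element against each test vector.\<close>

lemma form_matrix_mult:
  assumes "bounded_sesquilinear s"
  shows "(form_matrix s \<phi> \<psi> *v u) $ i = s (synthesis \<phi> u) (\<psi> i)"
  by (simp add: form_matrix_def matrix_vector_mult_def synthesis_def sesquilinear_sum_left[OF assms]
      mult.commute)

lemma synthesis_add: "synthesis \<phi> (u + v) = synthesis \<phi> u + synthesis \<phi> v"
  by (simp add: synthesis_def scaleC_add_left sum.distrib)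

lemma synthesis_scale: "synthesis \<phi> (c *s u) = c *\<^sub>C synthesis \<phi> u"
  by (simp add: synthesis_def complex_vector.scale_sum_right scaleC_scaleC)

lemma synthesis_diff: "synthesis \<phi> (u - v) = synthesis \<phi> u - synthesis \<phi> v"
  using synthesis_add[of \<phi> "u - v" v] by simp

lemma synthesis_zero: "synthesis \<phi> 0 = 0"
  using synthesis_diff[of \<phi> 0 0] by simp

lemma range_synthesis:
  fixes \<phi> :: "'n::finite \<Rightarrow> 'a::complex_vector"
  assumes "is_basis \<phi> S"
  shows "range (synthesis \<phi>) = S"
proof -
  have inj: "inj \<phi>" and S: "S = complex_vector.span (range \<phi>)"
    using assms by (auto simp: is_basis_def)
  have "S = range (\<lambda>u. \<Sum>v\<in>range \<phi>. u v *\<^sub>C v)"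
    unfolding S by (rule complex_vector.span_finite) simp
  also have "\<dots> = range (\<lambda>u. \<Sum>i\<in>UNIV. u (\<phi> i) *\<^sub>C \<phi> i)"
    by (simp add: sum.reindex[OF inj])
  also have "\<dots> = range (synthesis \<phi>)"
  proof (intro equalityI subsetI)
    fix y assume "y \<in> range (\<lambda>u. \<Sum>i\<in>UNIV. u (\<phi> i) *\<^sub>C \<phi> i)"
    then obtain u where "y = (\<Sum>i\<in>UNIV. u (\<phi> i) *\<^sub>C \<phi> i)" by auto
    then have "y = synthesis \<phi> (\<chi> i. u (\<phi> i))" by (simp add: synthesis_def)
    then show "y \<in> range (synthesis \<phi>)" by blast
  next
    fix y assume "y \<in> range (synthesis \<phi>)"
    then obtain u where "y = synthesis \<phi> u" by auto
    \<comment> \<open>Coordinates are indexed by \<open>'n\<close>, the coefficients in the span by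
      vectors; \<open>inv \<phi>\<close> translates between the two because \<open>\<phi>\<close> is
      injective.\<close>
    then have "y = (\<Sum>i\<in>UNIV. (u $ inv \<phi> (\<phi> i)) *\<^sub>C \<phi> i)"
      using inj by (simp add: synthesis_def)
    then show "y \<in> range (\<lambda>u. \<Sum>i\<in>UNIV. u (\<phi> i) *\<^sub>C \<phi> i)"
      by (rule image_eqI[where x = "\<lambda>v. u $ inv \<phi> v"]) simp
  qed
  finally show ?thesis by simp
qed

lemma synthesis_eq_0_iff:
  fixes \<phi> :: "'n::finite \<Rightarrow> 'a::complex_vector"
  assumes "is_basis \<phi> S"
  shows "synthesis \<phi> u = 0 \<longleftrightarrow> u = 0"
proof
  assume 0: "synthesis \<phi> u = 0"
  have inj: "inj \<phi>" and ind: "\<not> complex_vector.dependent (range \<phi>)"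
    using assms by (auto simp: is_basis_def)
  have "(\<Sum>v\<in>range \<phi>. (u $ inv \<phi> v) *\<^sub>C v) = 0"
    using 0 inj by (simp add: sum.reindex[OF inj] synthesis_def)
  then have "u $ inv \<phi> v = 0" if "v \<in> range \<phi>" for v
    using complex_vector.independentD[OF ind, of "range \<phi>" "\<lambda>v. u $ inv \<phi> v" v] that by auto
  then have "u $ i = 0" for i using inj by (metis inv_f_f rangeI)
  then show "u = 0" by (simp add: vec_eq_iff)
qed (simp add: synthesis_zero)

lemma inj_synthesis:
  fixes \<phi> :: "'n::finite \<Rightarrow> 'a::complex_vector"
  assumes "is_basis \<phi> S"
  shows "inj (synthesis \<phi>)"
  using synthesis_eq_0_iff[OF assms] by (metis injI right_minus_eq synthesis_diff)

text \<open>Both functionals are antilinear on \<open>T\<close>, hence determined by their values on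
  a basis of \<open>T\<close>. This turns equalities in the antidual of \<open>T\<close> into
  finitely many scalar equations.\<close>

lemma discrete_op_eq_iff:
  fixes \<psi> :: "'n::finite \<Rightarrow> 'b::complex_normed_vector"
  assumes \<psi>: "is_basis \<psi> T" and s: "bounded_sesquilinear s" "bounded_sesquilinear s'"
  shows "discrete_op T s u = discrete_op T s' u' \<longleftrightarrow> (\<forall>i. s u (\<psi> i) = s' u' (\<psi> i))"
proof
  assume eq: "discrete_op T s u = discrete_op T s' u'"
  have "\<psi> i \<in> T" for i
    using \<psi> by (auto simp: is_basis_def intro: complex_vector.span_base)
  then show "\<forall>i. s u (\<psi> i) = s' u' (\<psi> i)"
    using eq by (auto simp: discrete_op_def fun_eq_iff restrict_def) metis
next
  assume eq: "\<forall>i. s u (\<psi> i) = s' u' (\<psi> i)"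
  have "s u (synthesis \<psi> w) = s' u' (synthesis \<psi> w)" for w
    unfolding synthesis_def using eq by (simp add: sesquilinear_sum_right s)
  then have "s u y = s' u' y" if "y \<in> T" for y
    using that range_synthesis[OF \<psi>] by auto
  then show "discrete_op T s u = discrete_op T s' u'"
    by (auto simp: discrete_op_def fun_eq_iff)
qed

lemma discrete_op_synthesis_eq_iff:
  fixes \<psi> :: "'n::finite \<Rightarrow> 'b::complex_normed_vector"
  assumes "is_basis \<psi> T" "bounded_sesquilinear s" "bounded_sesquilinear s'"
  shows "discrete_op T s (synthesis \<phi> u) = discrete_op T s' (synthesis \<phi>' u')
    \<longleftrightarrow> form_matrix s \<phi> \<psi> *v u = form_matrix s' \<phi>' \<psi> *v u'"
  by (simp add: discrete_op_eq_iff[OF assms] vec_eq_iff form_matrix_mult assms)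

lemma matrix_inv_inverse:
  fixes A :: "'a::field ^ 'n ^ 'n"
  assumes "invertible A"
  shows matrix_inv_right: "A ** matrix_inv A = mat 1" and matrix_inv_left: "matrix_inv A ** A = mat 1"
  using someI_ex[OF assms[unfolded invertible_def]] unfolding matrix_inv_def by auto

lemma invertible_matrix_inv:
  fixes A :: "'a::field ^ 'n ^ 'n"
  shows "invertible A \<Longrightarrow> invertible (matrix_inv A)"
  unfolding invertible_def[of "matrix_inv A"] using matrix_inv_inverse by blast

section \<open>Consequences of the inf-sup conditions\<close>

text \<open>The index type is inhabited and independent vectors are nonzero. Suprema over
  \<open>T - {0}\<close> therefore range over a nonempty set and have their intended value.\<close>

lemma is_basis_nonzero:
  fixes \<phi> :: "'n::finite \<Rightarrow> 'a::complex_vector"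
  assumes "is_basis \<phi> S"
  shows "\<exists>u\<in>S. u \<noteq> 0"
proof (intro bexI)
  fix i
  show "\<phi> i \<noteq> 0" "\<phi> i \<in> S"
    using assms complex_vector.dependent_zero[of "range \<phi>"] rangeI[of \<phi> i]
    by (auto simp: is_basis_def intro: complex_vector.span_base)
qed

text \<open>A coordinate vector in the kernel represents an element whose functional vanishes on
  \<open>T\<close>. Its supremum is 0, so the inf-sup condition forces the element to be 0; a square
  matrix with trivial kernel is invertible.\<close>

lemma discrete_inf_sup_invertible:
  fixes \<phi> :: "'n::finite \<Rightarrow> 'a::complex_normed_vector" and \<psi> :: "'n \<Rightarrow> 'b::complex_normed_vector"
  assumes s: "bounded_sesquilinear s" and infsup: "discrete_inf_sup S T s \<gamma>"
    and \<phi>: "is_basis \<phi> S" and \<psi>: "is_basis \<psi> T"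
  shows "invertible (form_matrix s \<phi> \<psi>)"
proof -
  have "u = 0" if "form_matrix s \<phi> \<psi> *v u = 0" for u
  proof -
    have "discrete_op T s (synthesis \<phi> u) = discrete_op T s (synthesis \<phi> 0)"
      using that by (simp add: discrete_op_synthesis_eq_iff[OF \<psi> s s])
    then have "s (synthesis \<phi> u) v = 0" if "v \<in> T" for v
      using that by (metis discrete_op_def restrict_apply' sesquilinear_zero(1)[OF s] synthesis_zero)
    then have "(SUP v\<in>T - {0}. cmod (s (synthesis \<phi> u) v) / norm v) = (SUP v\<in>T - {0}. 0)"
      by (intro SUP_cong) auto
    also have "\<dots> = 0"
      using is_basis_nonzero[OF \<psi>] by (subst cSUP_const) auto
    finally have zero: "(SUP v\<in>T - {0}. cmod (s (synthesis \<phi> u) v) / norm v) = 0" .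
    have "synthesis \<phi> u \<in> S" using range_synthesis[OF \<phi>] by blast
    \<comment> \<open>Rewriting the real number 0 back into the supremum makes both claims literal
      instances of the inf-sup condition.\<close>
    then have "\<gamma> * norm (synthesis \<phi> u) \<le> 0" "\<gamma> > 0"
      using infsup unfolding discrete_inf_sup_def zero[symmetric] by blast+
    then have "synthesis \<phi> u = 0"
      by (simp add: mult_le_0_iff)
    then show "u = 0" by (simp add: synthesis_eq_0_iff[OF \<phi>])
  qed
  then show ?thesis
    by (meson invertible_left_inverse matrix_left_invertible_ker)
qed

text \<open>At one nonzero \<open>u\<close> the supremum lies between
  \<open>\<gamma> * norm u\<close> and \<open>C * norm u\<close>. In the main proof this yields that
  all continuity constants are positive.\<close>

lemma discrete_inf_sup_le_continuity:
  fixes \<phi> :: "'n::finite \<Rightarrow> 'a::complex_normed_vector" and \<psi> :: "'n \<Rightarrow> 'b::complex_normed_vector"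
  assumes infsup: "discrete_inf_sup S T s \<gamma>" and C: "discrete_continuity S T s C"
    and \<phi>: "is_basis \<phi> S" and \<psi>: "is_basis \<psi> T"
  shows "\<gamma> \<le> C"
proof -
  obtain u where u: "u \<in> S" "u \<noteq> 0" using is_basis_nonzero[OF \<phi>] by blast
  have "(SUP v\<in>T - {0}. cmod (s u v) / norm v) \<le> C * norm u"
    using is_basis_nonzero[OF \<psi>] C u
    by (intro cSUP_least) (auto simp: divide_simps discrete_continuity_def)
  moreover have "\<gamma> * norm u \<le> (SUP v\<in>T - {0}. cmod (s u v) / norm v)"
    using infsup u by (simp add: discrete_inf_sup_def)
  ultimately have "\<gamma> * norm u \<le> C * norm u" by linarith
  then show ?thesis using u by simp
qed

lemma discrete_continuity_form_norm:
  assumes "bounded_sesquilinear s"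
  shows "discrete_continuity S T s (form_norm s)"
  unfolding discrete_continuity_def
proof (intro ballI)
  fix u v
  obtain K where K: "\<And>x y. cmod (s x y) \<le> K * norm x * norm y"
    using assms by (auto simp: bounded_sesquilinear_def)
  show "cmod (s u v) \<le> form_norm s * norm u * norm v"
  proof (cases "u = 0 \<or> v = 0")
    case False
    \<comment> \<open>A real supremum dominates its members only if the set is bounded above;
      boundedness of the form supplies this.\<close>
    have "bdd_above ((\<lambda>(x, y). cmod (s x y) / (norm x * norm y)) ` {(x, y). x \<noteq> 0 \<and> y \<noteq> 0})"
      using K by (intro bdd_aboveI[of _ K]) (auto simp: divide_simps mult.assoc)
    then have "cmod (s u v) / (norm u * norm v) \<le> form_norm s"
      unfolding form_norm_def using False by (intro cSUP_upper2[of _ _ "(u, v)"]) auto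
    then show ?thesis using False by (simp add: divide_simps mult.assoc)
  qed (auto simp: sesquilinear_zero[OF assms])
qed

text \<open>Inverting the operator of \<open>s\<close> at a functional induced by \<open>s'\<close>
  means solving a variational problem on \<open>T\<close>, in coordinates a linear system with the
  matrix of \<open>s\<close>. Applied with \<open>n\<close> against \<open>a\<^sub>\<nu>\<close> and
  then with \<open>m\<close> against \<open>c\<^sub>\<mu>\<close>, it evaluates the preconditioned
  operator.\<close>

lemma inv_discrete_op:
  fixes \<phi> :: "'n::finite \<Rightarrow> 'a::complex_normed_vector" and \<psi> :: "'n \<Rightarrow> 'b::complex_normed_vector"
  assumes s: "bounded_sesquilinear s" and s': "bounded_sesquilinear s'"
    and inv: "invertible (form_matrix s \<phi> \<psi>)"
    and \<phi>: "is_basis \<phi> S" and \<psi>: "is_basis \<psi> T"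
  shows "inv_into S (discrete_op T s) (discrete_op T s' (synthesis \<phi>' u))
    = synthesis \<phi> (matrix_inv (form_matrix s \<phi> \<psi>) *v (form_matrix s' \<phi>' \<psi> *v u))"
proof -
  define w where "w = matrix_inv (form_matrix s \<phi> \<psi>) *v (form_matrix s' \<phi>' \<psi> *v u)"
  have mv: "form_matrix s \<phi> \<psi> *v w = form_matrix s' \<phi>' \<psi> *v u"
    by (simp add: w_def matrix_vector_mul_assoc matrix_mul_assoc matrix_inv_right[OF inv])
  have "inj_on (discrete_op T s) S"
  proof (rule inj_onI)
    fix y z assume "y \<in> S" "z \<in> S" and eq: "discrete_op T s y = discrete_op T s z"
    then obtain v v' where v: "y = synthesis \<phi> v" "z = synthesis \<phi> v'"
      using range_synthesis[OF \<phi>] by (metis imageE)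
    then have "form_matrix s \<phi> \<psi> *v v = form_matrix s \<phi> \<psi> *v v'"
      using eq by (simp add: discrete_op_synthesis_eq_iff[OF \<psi> s s])
    then have "v = v'"
      using inv by (metis matrix_inv_left matrix_vector_mul_assoc matrix_vector_mul_lid)
    then show "y = z" by (simp add: v)
  qed
  moreover have "discrete_op T s (synthesis \<phi> w) = discrete_op T s' (synthesis \<phi>' u)"
    by (simp add: discrete_op_synthesis_eq_iff[OF \<psi> s s'] mv)
  moreover have "synthesis \<phi> w \<in> S" using range_synthesis[OF \<phi>] by blast
  ultimately show ?thesis unfolding w_def[symmetric] by (metis inv_into_f_f)
qed

section \<open>Norms of coordinate vectors\<close>

lemma weighted_norm_gram:
  fixes \<phi> :: "'n::finite \<Rightarrow> 'a::complex_inner"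
  shows "weighted_norm (form_matrix cinner \<phi> \<phi>) u = norm (synthesis \<phi> u)"
proof -
  have left: "(form_matrix cinner \<phi> \<phi> *v u) $ i = cinner (synthesis \<phi> u) (\<phi> i)" for i
    by (simp add: form_matrix_def matrix_vector_mult_def synthesis_def cinner_sum_left
        cinner_scaleC_left mult.commute)
  have "cinner y (synthesis \<phi> u) = (\<Sum>i\<in>UNIV. cinner y (\<phi> i) * cnj (u $ i))" for y
    by (simp add: synthesis_def cinner_sum_right cinner_scaleC_right mult.commute)
  then have "dot2 (form_matrix cinner \<phi> \<phi> *v u) u = cinner (synthesis \<phi> u) (synthesis \<phi> u)"
    by (simp add: dot2_def left)
  then show ?thesis by (simp add: weighted_norm_def cinner_self)
qed

text \<open>The norm of the synthesised element is continuous on the compact unit sphere, so it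
  attains a minimum, positive by independence of the basis, and a maximum. Homogeneity carries both
  bounds to all nonzero coordinate vectors.\<close>

lemma synthesis_bounds:
  fixes \<phi> :: "'n::finite \<Rightarrow> 'a::complex_normed_vector"
  assumes \<phi>: "is_basis \<phi> S"
  shows "0 < synthesis_lower \<phi>"
    and "synthesis_lower \<phi> * norm u \<le> norm (synthesis \<phi> u)"
    and "norm (synthesis \<phi> u) \<le> synthesis_norm \<phi> * norm u"
    and "synthesis_lower \<phi> \<le> synthesis_norm \<phi>"
proof -
  let ?q = "\<lambda>u. norm (synthesis \<phi> u) / norm u"
  \<comment> \<open>Real homogeneity makes the synthesis map real-linear on a finite-dimensional
    space, hence continuous.\<close>
  have scaleR: "synthesis \<phi> (r *\<^sub>R v) = r *\<^sub>R synthesis \<phi> v" for r v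
  proof -
    have "r *\<^sub>R v = complex_of_real r *s v" by (simp add: vec_eq_iff scaleR_conv_of_real[symmetric])
    then show ?thesis by (simp only: synthesis_scale scaleR_scaleC)
  qed
  have "linear (synthesis \<phi>)"
    by (intro linearI synthesis_add scaleR)
  then have cont: "continuous_on A (\<lambda>u. norm (synthesis \<phi> u))" for A
    by (intro continuous_intros linear_continuous_on) (simp add: linear_conv_bounded_linear)
  have ne: "sphere (0 :: complex^'n) 1 \<noteq> {}" by simp
  obtain v where v: "v \<in> sphere 0 1" "\<And>w. w \<in> sphere 0 1 \<Longrightarrow> norm (synthesis \<phi> v) \<le> norm (synthesis \<phi> w)"
    using continuous_attains_inf[OF compact_sphere ne cont] by blast
  obtain v' where v': "\<And>w. w \<in> sphere 0 1 \<Longrightarrow> norm (synthesis \<phi> w) \<le> norm (synthesis \<phi> v')"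
    using continuous_attains_sup[OF compact_sphere ne cont] by blast
  have q: "?q u = norm (synthesis \<phi> ((1 / norm u) *\<^sub>R u))" "(1 / norm u) *\<^sub>R u \<in> sphere 0 1"
    if "u \<noteq> 0" for u
    using that by (simp_all add: scaleR)
  have lower: "norm (synthesis \<phi> v) \<le> ?q u" and upper: "?q u \<le> norm (synthesis \<phi> v')" if "u \<noteq> 0" for u
    unfolding q(1)[OF that] using v(2) v' q(2)[OF that] by blast+
  have iff: "{u. synthesis \<phi> u \<noteq> 0} = - {0}"
    by (auto simp: synthesis_eq_0_iff[OF \<phi>])
  have v0: "v \<noteq> 0" using v(1) by auto
  have "norm (synthesis \<phi> v) \<le> synthesis_lower \<phi>"
    unfolding synthesis_lower_def iff using v0 lower by (intro cINF_greatest) auto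
  moreover have "norm (synthesis \<phi> v) > 0"
    using v0 by (simp add: synthesis_eq_0_iff[OF \<phi>])
  ultimately show "0 < synthesis_lower \<phi>" by linarith
  have bdd: "bdd_below (?q ` (- {0}))" "bdd_above (?q ` (- {0}))"
    using lower upper by (auto intro!: bdd_belowI2 bdd_aboveI2)
  have bounds: "synthesis_lower \<phi> \<le> ?q u" "?q u \<le> synthesis_norm \<phi>" if "u \<noteq> 0" for u
    unfolding synthesis_lower_def synthesis_norm_def iff using that bdd
    by (auto intro!: cINF_lower cSUP_upper)
  then show "synthesis_lower \<phi> * norm u \<le> norm (synthesis \<phi> u)"
    "norm (synthesis \<phi> u) \<le> synthesis_norm \<phi> * norm u"
    by (cases "u = 0"; force simp: synthesis_zero field_simps)+
  show "synthesis_lower \<phi> \<le> synthesis_norm \<phi>"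
    using bounds[OF v0] by linarith
qed

section \<open>Minimal residual steps and GMRES\<close>

text \<open>Subtracting from \<open>u\<close> its orthogonal projection onto the line through
  \<open>w\<close> removes exactly the squared norm of that projection, by Pythagoras.\<close>

lemma minimal_residual_step:
  fixes u w :: "'a::complex_inner"
  assumes w: "w \<noteq> 0" and p: "0 \<le> p" "p * (norm u)\<^sup>2 \<le> cmod (cinner w u)"
    and q: "0 \<le> q" "q * (norm w)\<^sup>2 \<le> cmod (cinner u w)"
  shows "\<exists>\<alpha>. (norm (u - \<alpha> *\<^sub>C w))\<^sup>2 \<le> (1 - p * q) * (norm u)\<^sup>2"
proof -
  define \<alpha> where "\<alpha> = cinner u w / complex_of_real ((norm w)\<^sup>2)"
  define z where "z = u - \<alpha> *\<^sub>C w"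
  have u: "u = z + \<alpha> *\<^sub>C w" by (simp add: z_def)
  have "cinner u w = cinner z w + \<alpha> * complex_of_real ((norm w)\<^sup>2)"
    by (subst u) (simp only: cinner_add_left cinner_scaleC_left cinner_self)
  then have zw: "cinner z w = 0" "cinner w z = 0"
    using w cinner_commute[of w z] by (auto simp: \<alpha>_def)
  have "complex_of_real ((norm u)\<^sup>2) = cinner u u" by (simp only: cinner_self)
  also have "\<dots> = cinner z z + \<alpha> * cnj \<alpha> * cinner w w"
    by (subst (1 2) u)
      (simp add: cinner_add_left cinner_add_right cinner_scaleC_left cinner_scaleC_right zw)
  also have "\<dots> = complex_of_real ((norm z)\<^sup>2 + (cmod \<alpha>)\<^sup>2 * (norm w)\<^sup>2)"
    by (simp only: cinner_self complex_norm_square of_real_add of_real_mult)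
  finally have pyth: "(norm u)\<^sup>2 = (norm z)\<^sup>2 + (cmod \<alpha>)\<^sup>2 * (norm w)\<^sup>2"
    using of_real_eq_iff by blast
  have "cmod \<alpha> = cmod (cinner u w) / (norm w)\<^sup>2"
    by (simp add: \<alpha>_def norm_divide norm_power)
  \<comment> \<open>The square of \<open>cmod (cinner u w)\<close> is split into two
    conjugate-symmetric factors, so that one can be bounded by \<open>q\<close> and the other by
    \<open>p\<close>.\<close>
  then have "(cmod \<alpha>)\<^sup>2 * (norm w)\<^sup>2 = (cmod (cinner u w) * cmod (cinner w u)) / (norm w)\<^sup>2"
    using w by (subst (2) cinner_commute) (simp add: field_simps power2_eq_square)
  also have "\<dots> \<ge> (q * (norm w)\<^sup>2 * (p * (norm u)\<^sup>2)) / (norm w)\<^sup>2"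
    using p q by (intro divide_right_mono mult_mono) auto
  also have "(q * (norm w)\<^sup>2 * (p * (norm u)\<^sup>2)) / (norm w)\<^sup>2 = p * q * (norm u)\<^sup>2"
    using w by simp
  finally have "(norm z)\<^sup>2 \<le> (1 - p * q) * (norm u)\<^sup>2"
    using pyth by (simp add: algebra_simps)
  then show ?thesis unfolding z_def by blast
qed

lemma krylov_mono: "z \<in> krylov t Q r \<Longrightarrow> z \<in> krylov (Suc t) Q r"
  unfolding krylov_def
  using vec.span_mono[of "{(((*v) Q) ^^ j) r | j. j < t}" "{(((*v) Q) ^^ j) r | j. j < Suc t}"]
  by (auto simp: less_Suc_eq)

lemma krylov_residual:
  assumes "z \<in> krylov t Q r"
  shows "r - Q *v z \<in> krylov (Suc t) Q r"
proof -
  have "Q *v z \<in> vec.span ((*v) Q ` {(((*v) Q) ^^ j) r | j. j < t})"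
    using assms unfolding krylov_def
    by (subst vec.linear_span_image[OF matrix_vector_mul_linear_gen]) auto
  also have "\<dots> \<subseteq> krylov (Suc t) Q r"
    unfolding krylov_def
  proof (intro vec.span_mono subsetI)
    fix y assume "y \<in> (*v) Q ` {(((*v) Q) ^^ j) r | j. j < t}"
    then obtain j where "j < t" "y = (((*v) Q) ^^ Suc j) r" by auto
    then show "y \<in> {(((*v) Q) ^^ j) r | j. j < Suc t}" by blast
  qed
  finally have "Q *v z \<in> krylov (Suc t) Q r" .
  moreover have "r \<in> krylov (Suc t) Q r"
    unfolding krylov_def by (intro vec.span_base CollectI exI[of _ 0]) auto
  ultimately show ?thesis
    unfolding krylov_def by (intro vec.span_diff)
qed

text \<open>Each step adds a multiple of the current residual to the correction \<open>z\<close>.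
  That residual lies in the next Krylov space, so \<open>t\<close> steps stay within dimension index
  \<open>t\<close>, although \<open>\<alpha>\<close> changes from step to step.\<close>

lemma krylov_reduction:
  fixes N :: "complex ^ 'n \<Rightarrow> real"
  assumes \<rho>: "0 \<le> \<rho>" and step: "\<And>r. \<exists>\<alpha>. N (r - \<alpha> *s (Q *v r)) \<le> \<rho> * N r"
  shows "\<exists>z\<in>krylov t Q r. N (r - Q *v z) \<le> \<rho> ^ t * N r"
proof (induction t)
  case 0
  show ?case by (intro bexI[of _ 0]) (auto simp: krylov_def vec.span_zero)
next
  case (Suc t)
  then obtain z where z: "z \<in> krylov t Q r" and le: "N (r - Q *v z) \<le> \<rho> ^ t * N r" by blast
  obtain \<alpha> where \<alpha>: "N (r - Q *v z - \<alpha> *s (Q *v (r - Q *v z))) \<le> \<rho> * N (r - Q *v z)"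
    using step by blast
  define y where "y = z + \<alpha> *s (r - Q *v z)"
  have "y \<in> krylov (Suc t) Q r"
    using krylov_mono[OF z] krylov_residual[OF z] unfolding y_def krylov_def
    by (intro vec.span_add vec.span_scale)
  moreover have "Q *v (\<alpha> *s v) = \<alpha> *s (Q *v v)" for v
    by (simp add: vector_scalar_commute)
  then have "r - Q *v y = r - Q *v z - \<alpha> *s (Q *v (r - Q *v z))"
    unfolding y_def by (simp only: matrix_vector_right_distrib diff_diff_add)
  moreover have "\<rho> * N (r - Q *v z) \<le> \<rho> ^ Suc t * N r"
    using mult_left_mono[OF le \<rho>] by (simp add: mult.assoc)
  ultimately show ?case using \<alpha> by (metis order_trans)
qed

text \<open>GMRES minimizes \<open>nrm\<close>, while the one-step reduction holds in
  \<open>N\<close>. Within a cycle the comparison point is measured in \<open>N\<close>, and the two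
  changes of norm cost \<open>G / g\<close> once. Strong induction on \<open>k\<close> goes back to
  the start of the current cycle.\<close>

lemma gmres_reduction:
  fixes N nrm :: "complex ^ 'n \<Rightarrow> real"
  assumes \<rho>: "0 \<le> \<rho>" and step: "\<And>r. \<exists>\<alpha>. N (r - \<alpha> *s (Q *v r)) \<le> \<rho> * N r"
    and lower: "0 < g" "\<And>r. g * nrm r \<le> N r" and upper: "\<And>r. N r \<le> G * nrm r" and "g \<le> G"
    and nonneg: "\<And>r. 0 \<le> nrm r"
    and gmres: "gmres_iterates l nrm Q d x0 x" and "1 \<le> l"
  shows "nrm (d - Q *v x k) \<le> (G / g * \<rho>) ^ k * nrm (d - Q *v x0)"
proof (induction k rule: less_induct)
  case (less k)
  show ?case
  proof (cases k)
    case 0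
    then show ?thesis using gmres by (simp add: gmres_iterates_def)
  next
    case (Suc k')
    \<comment> \<open>Dividing \<open>k - 1\<close> instead of \<open>k\<close> gives
      \<open>t\<close> the range from 1 to \<open>l\<close>, so a multiple of \<open>l\<close>
      counts as the end of a cycle and not as the start of the next.\<close>
    define i where "i = k' div l"
    define t where "t = Suc (k' mod l)"
    have t: "1 \<le> t" "t \<le> l" and k: "k = i * l + t"
      using \<open>1 \<le> l\<close> by (auto simp: t_def i_def Suc Suc_le_eq)
    have C: "1 \<le> G / g" using \<open>g \<le> G\<close> lower(1) by simp
    let ?r = "d - Q *v x (i * l)"
    obtain z where z: "z \<in> krylov t Q ?r" "N (?r - Q *v z) \<le> \<rho> ^ t * N ?r"
      using krylov_reduction[OF \<rho> step] by blast
    have "is_arg_min (\<lambda>z. nrm (d - Q *v z)) (\<lambda>z. z \<in> (+) (x (i * l)) ` krylov t Q ?r) (x k)"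
      using gmres t unfolding gmres_iterates_def k by blast
    then have "nrm (d - Q *v x k) \<le> nrm (d - Q *v (x (i * l) + z))"
      using z(1) by (auto simp: is_arg_min_linorder)
    also have "\<dots> = nrm (?r - Q *v z)"
      by (simp add: matrix_vector_right_distrib algebra_simps)
    also have "\<dots> \<le> N (?r - Q *v z) / g"
      using lower by (simp add: field_simps)
    also have "\<dots> \<le> \<rho> ^ t * (G * nrm ?r) / g"
      using lower(1) z(2) \<rho> order_trans[OF z(2) mult_left_mono[OF upper]]
      by (intro divide_right_mono) auto
    also have "\<dots> = (G / g) * \<rho> ^ t * nrm ?r" by simp
    \<comment> \<open>Since \<open>G / g\<close> is at least 1 and \<open>t\<close> is positive, the
      single factor is absorbed into a \<open>t\<close>-th power, which gives a uniform rate per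
      step.\<close>
    also have "\<dots> \<le> (G / g) ^ t * \<rho> ^ t * nrm ?r"
      using C t \<rho> nonneg by (intro mult_right_mono self_le_power) auto
    also have "\<dots> = (G / g * \<rho>) ^ t * nrm ?r" by (simp only: power_mult_distrib)
    also have "\<dots> \<le> (G / g * \<rho>) ^ t * ((G / g * \<rho>) ^ (i * l) * nrm (d - Q *v x0))"
      using less[of "i * l"] k t(1) C \<rho> by (intro mult_left_mono zero_le_power mult_nonneg_nonneg) auto
    also have "\<dots> = (G / g * \<rho>) ^ k * nrm (d - Q *v x0)"
      by (simp add: k power_add mult_ac)
    finally show ?thesis .
  qed
qed

lemma root_quotient_le:
  fixes q :: real
  assumes "1 \<le> k" "0 \<le> q" "0 < r0" "r \<le> q ^ k * r0"
  shows "root k (r / r0) \<le> q"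
proof -
  have "r / r0 \<le> q ^ k" using assms by (simp add: divide_le_eq)
  then have "root k (r / r0) \<le> root k (q ^ k)" using assms by simp
  then show ?thesis using assms by (simp add: real_root_power_cancel)
qed

text \<open>The quotients are bounded below by 0, so their infimum lies below each of them.\<close>

lemma num_range_dist_le:
  fixes Q :: "'a::complex_inner \<Rightarrow> 'a"
  assumes "p \<le> num_range_dist S Q" "u \<in> S" "u \<noteq> 0"
  shows "p * (norm u)\<^sup>2 \<le> cmod (cinner (Q u) u)"
proof -
  have "num_range_dist S Q \<le> cmod (cinner (Q u) u) / Re (cinner u u)"
    unfolding num_range_dist_def using assms
    by (intro cINF_lower bdd_belowI2[of _ 0]) (auto simp: cinner_self)
  with assms(1) have "p \<le> cmod (cinner (Q u) u) / (norm u)\<^sup>2"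
    by (simp add: cinner_self)
  then show ?thesis
    using assms(3) by (simp add: field_simps)
qed

theorem theorem4:
  fixes a a\<^sub>\<nu> :: "'x::complex_hilbert \<Rightarrow> 'y::complex_banach \<Rightarrow> complex"
    and c c\<^sub>\<mu> :: "'v::complex_banach \<Rightarrow> 'w::complex_banach \<Rightarrow> complex"
    and n :: "'v \<Rightarrow> 'y \<Rightarrow> complex"
    and m :: "'x \<Rightarrow> 'w \<Rightarrow> complex"
    and b b\<^sub>\<nu> :: "'y \<Rightarrow> complex"
    and X\<^sub>h :: "'x set" and Y\<^sub>h :: "'y set" and V\<^sub>h :: "'v set" and W\<^sub>h :: "'w set"
    and \<gamma>A \<gamma>C \<gamma>N \<gamma>M \<gamma>A\<^sub>\<nu> \<gamma>C\<^sub>\<mu> norm_a\<^sub>\<nu> norm_c\<^sub>\<mu> \<mu> \<nu> K K\<^sub>\<Lambda> :: real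
    and \<phi>X :: "'n::finite \<Rightarrow> 'x" and \<phi>Y :: "'n \<Rightarrow> 'y" and \<phi>V :: "'n \<Rightarrow> 'v" and \<phi>W :: "'n \<Rightarrow> 'w"
    and P\<^sub>h :: "('y \<Rightarrow> complex) \<Rightarrow> 'x" and A\<^sub>h :: "'x \<Rightarrow> 'y \<Rightarrow> complex"
    and A P H :: "complex ^ 'n ^ 'n"
    and f x0 :: "complex ^ 'n"
    and x x' :: "nat \<Rightarrow> complex ^ 'n"
    and k l :: nat
  assumes reflexive:
      "reflexive_space TYPE('y)" "reflexive_space TYPE('v)" "reflexive_space TYPE('w)"
    and forms: "bounded_sesquilinear a" "bounded_sesquilinear c"
      "bounded_sesquilinear n" "bounded_sesquilinear m"
    and well_posed: "\<forall>g\<in>antidual. \<exists>!u. \<forall>v. a u v = g v"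
    and rhs: "b \<in> antidual"
    and subspaces: "complex_vector.subspace X\<^sub>h" "complex_vector.subspace Y\<^sub>h"
      "complex_vector.subspace V\<^sub>h" "complex_vector.subspace W\<^sub>h"
    and dims: "complex_vector.dim X\<^sub>h = CARD('n)" "complex_vector.dim Y\<^sub>h = CARD('n)"
      "complex_vector.dim V\<^sub>h = CARD('n)" "complex_vector.dim W\<^sub>h = CARD('n)"
    and inf_sup: "discrete_inf_sup X\<^sub>h Y\<^sub>h a \<gamma>A" "discrete_inf_sup V\<^sub>h W\<^sub>h c \<gamma>C"
      "discrete_inf_sup V\<^sub>h Y\<^sub>h n \<gamma>N" "discrete_inf_sup X\<^sub>h W\<^sub>h m \<gamma>M"
    and range: "0 \<le> \<mu>" "\<mu> < 1" "0 \<le> \<nu>" "\<nu> < 1"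
    and perturbed: "c\<^sub>\<mu> \<in> form_perturbations V\<^sub>h W\<^sub>h \<gamma>C \<mu> c"
      "a\<^sub>\<nu> \<in> form_perturbations X\<^sub>h Y\<^sub>h \<gamma>A \<nu> a"
      "b\<^sub>\<nu> \<in> rhs_perturbations Y\<^sub>h \<nu> b"
    and consts_a\<^sub>\<nu>: "discrete_inf_sup X\<^sub>h Y\<^sub>h a\<^sub>\<nu> \<gamma>A\<^sub>\<nu>" "\<gamma>A\<^sub>\<nu> \<ge> (1 - \<nu>) * \<gamma>A"
      "discrete_continuity X\<^sub>h Y\<^sub>h a\<^sub>\<nu> norm_a\<^sub>\<nu>" "norm_a\<^sub>\<nu> \<le> (1 + \<nu>) * form_norm a"
    and consts_c\<^sub>\<mu>: "discrete_inf_sup V\<^sub>h W\<^sub>h c\<^sub>\<mu> \<gamma>C\<^sub>\<mu>" "\<gamma>C\<^sub>\<mu> \<ge> (1 - \<mu>) * \<gamma>C"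
      "discrete_continuity V\<^sub>h W\<^sub>h c\<^sub>\<mu> norm_c\<^sub>\<mu>" "norm_c\<^sub>\<mu> \<le> (1 + \<mu>) * form_norm c"
    and P\<^sub>h: "P\<^sub>h = inv_into X\<^sub>h (discrete_op W\<^sub>h m) \<circ> discrete_op W\<^sub>h c\<^sub>\<mu> \<circ> inv_into V\<^sub>h (discrete_op Y\<^sub>h n)"
    and A\<^sub>h: "A\<^sub>h = discrete_op Y\<^sub>h a\<^sub>\<nu>"
    and num_range: "\<gamma>C\<^sub>\<mu> * \<gamma>A\<^sub>\<nu> / (form_norm m * form_norm n) \<le> num_range_dist X\<^sub>h (P\<^sub>h \<circ> A\<^sub>h)"
      "\<gamma>M * \<gamma>N / (norm_c\<^sub>\<mu> * norm_a\<^sub>\<nu>) \<le> num_range_dist X\<^sub>h (inv_into X\<^sub>h (P\<^sub>h \<circ> A\<^sub>h))"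
    and bases: "is_basis \<phi>X X\<^sub>h" "is_basis \<phi>Y Y\<^sub>h" "is_basis \<phi>V V\<^sub>h" "is_basis \<phi>W W\<^sub>h"
    and A: "A = form_matrix a\<^sub>\<nu> \<phi>X \<phi>Y"
    and P: "P = matrix_inv (form_matrix m \<phi>X \<phi>W) ** form_matrix c\<^sub>\<mu> \<phi>V \<phi>W
                 ** matrix_inv (form_matrix n \<phi>V \<phi>Y)"
    and f: "f = rhs_vector b\<^sub>\<nu> \<phi>Y"
    and H: "H = form_matrix cinner \<phi>X \<phi>X"
    and initial: "(P ** A) *v x0 \<noteq> P *v f"
    and kl: "1 \<le> k" "k \<le> CARD('n)" "1 \<le> l" "l \<le> CARD('n)"
    and weighted: "gmres_iterates l (weighted_norm H) (P ** A) (P *v f) x0 x"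
    and euclidean: "gmres_iterates l norm (P ** A) (P *v f) x0 x'"
    and K: "K = form_norm m * form_norm n * form_norm c * form_norm a / (\<gamma>M * \<gamma>N * \<gamma>C * \<gamma>A)
                 * ((1 + \<mu>) / (1 - \<mu>)) * ((1 + \<nu>) / (1 - \<nu>))"
    and K\<^sub>\<Lambda>: "K\<^sub>\<Lambda> = synthesis_cond \<phi>X"
  shows "root k (weighted_norm H (P *v (f - A *v x k)) / weighted_norm H (P *v (f - A *v x0)))
           \<le> sqrt (1 - 1 / K)
       \<and> root k (norm (P *v (f - A *v x' k)) / norm (P *v (f - A *v x0)))
           \<le> K\<^sub>\<Lambda> * sqrt (1 - 1 / K)"
proof -

  \<comment> \<open>The preconditioned operator and its inverse in coordinates\<close>
  have forms': "bounded_sesquilinear c\<^sub>\<mu>" "bounded_sesquilinear a\<^sub>\<nu>"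
    using perturbed by (auto simp: form_perturbations_def)
  define Q where "Q = P ** A"
  define L where "L = synthesis \<phi>X"
  define p where "p = \<gamma>C\<^sub>\<mu> * \<gamma>A\<^sub>\<nu> / (form_norm m * form_norm n)"
  define q where "q = \<gamma>M * \<gamma>N / (norm_c\<^sub>\<mu> * norm_a\<^sub>\<nu>)"
  define \<rho> where "\<rho> = sqrt (1 - 1 / K)"
  note invN = discrete_inf_sup_invertible[OF forms(3) inf_sup(3) bases(3,2)]
  note invM = discrete_inf_sup_invertible[OF forms(4) inf_sup(4) bases(1,4)]
  note invA = discrete_inf_sup_invertible[OF forms'(2) consts_a\<^sub>\<nu>(1) bases(1,2)]
  note invC = discrete_inf_sup_invertible[OF forms'(1) consts_c\<^sub>\<mu>(1) bases(3,4)]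
  have invQ: "invertible Q"
    unfolding Q_def P A
    by (intro invertible_mult invertible_matrix_inv invN invM invA invC)
  have op: "(P\<^sub>h \<circ> A\<^sub>h) (L u) = L (Q *v u)" for u
    by (simp add: L_def P\<^sub>h A\<^sub>h Q_def P A matrix_vector_mul_assoc matrix_mul_assoc
        inv_discrete_op[OF forms(3) forms'(2) invN bases(3,2)]
        inv_discrete_op[OF forms(4) forms'(1) invM bases(1,4)])
  have LX: "range L = X\<^sub>h" using range_synthesis[OF bases(1)] by (simp add: L_def)
  have L0: "L u = 0 \<longleftrightarrow> u = 0" for u using synthesis_eq_0_iff[OF bases(1)] by (simp add: L_def)
  have Qinj: "Q *v u = Q *v v \<Longrightarrow> u = v" for u v
    using invQ by (metis matrix_inv_left matrix_vector_mul_assoc matrix_vector_mul_lid)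
  have "inj_on (P\<^sub>h \<circ> A\<^sub>h) X\<^sub>h"
  proof (rule inj_onI)
    fix y z assume "y \<in> X\<^sub>h" "z \<in> X\<^sub>h" and eq: "(P\<^sub>h \<circ> A\<^sub>h) y = (P\<^sub>h \<circ> A\<^sub>h) z"
    then obtain u v where "y = L u" "z = L v" using LX by (metis imageE)
    then show "y = z"
      using eq op Qinj inj_synthesis[OF bases(1)] by (metis L_def injD)
  qed
  \<comment> \<open>With this, the numerical range hypothesis on the inverse, taken at
    \<open>L (Q *v r)\<close>, becomes a bound on \<open>cinner (L r) (L (Q *v r))\<close>.\<close>
  then have inv_op: "inv_into X\<^sub>h (P\<^sub>h \<circ> A\<^sub>h) (L (Q *v u)) = L u" for u
    unfolding op[symmetric] using LX by (intro inv_into_f_f) auto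

  \<comment> \<open>Positivity of the constants and comparison of \<open>1 / K\<close> with
    \<open>p * q\<close>\<close>
  note continuity = discrete_continuity_form_norm
  have pos: "\<gamma>A > 0" "\<gamma>C > 0" "\<gamma>N > 0" "\<gamma>M > 0" "\<gamma>A\<^sub>\<nu> > 0" "\<gamma>C\<^sub>\<mu> > 0"
    using inf_sup consts_a\<^sub>\<nu>(1) consts_c\<^sub>\<mu>(1) by (auto simp: discrete_inf_sup_def)
  have norm_pos: "form_norm a > 0" "form_norm c > 0" "form_norm n > 0" "form_norm m > 0"
      "norm_a\<^sub>\<nu> > 0" "norm_c\<^sub>\<mu> > 0"
    using pos
      discrete_inf_sup_le_continuity[OF inf_sup(1) continuity[OF forms(1)] bases(1,2)]
      discrete_inf_sup_le_continuity[OF inf_sup(2) continuity[OF forms(2)] bases(3,4)]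
      discrete_inf_sup_le_continuity[OF inf_sup(3) continuity[OF forms(3)] bases(3,2)]
      discrete_inf_sup_le_continuity[OF inf_sup(4) continuity[OF forms(4)] bases(1,4)]
      discrete_inf_sup_le_continuity[OF consts_a\<^sub>\<nu>(1,3) bases(1,2)]
      discrete_inf_sup_le_continuity[OF consts_c\<^sub>\<mu>(1,3) bases(3,4)]
    by linarith+
  have pq0: "0 \<le> p" "0 \<le> q" using pos norm_pos by (auto simp: p_def q_def)
  \<comment> \<open>Each perturbation factor is grouped with the constant it modifies, so that
    numerator and denominator compare factor by factor with those of \<open>p * q\<close>.\<close>
  have "1 / K = ((1 - \<mu>) * \<gamma>C * ((1 - \<nu>) * \<gamma>A) * (\<gamma>M * \<gamma>N))
      / (form_norm m * form_norm n * ((1 + \<mu>) * form_norm c * ((1 + \<nu>) * form_norm a)))"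
    by (simp add: K mult_ac)
  also have "\<dots> \<le> (\<gamma>C\<^sub>\<mu> * \<gamma>A\<^sub>\<nu> * (\<gamma>M * \<gamma>N)) / (form_norm m * form_norm n * (norm_c\<^sub>\<mu> * norm_a\<^sub>\<nu>))"
    using pos norm_pos range consts_a\<^sub>\<nu>(2,4) consts_c\<^sub>\<mu>(2,4)
    by (intro frac_le mult_mono mult_pos_pos mult_nonneg_nonneg) auto
  also have "\<dots> = p * q" by (simp add: p_def q_def)
  finally have K_le: "1 / K \<le> p * q" .

  \<comment> \<open>One-step reduction of the residual\<close>
  have step_sq: "\<exists>\<alpha>. (norm (L (r - \<alpha> *s (Q *v r))))\<^sup>2 \<le> (1 - 1 / K) * (norm (L r))\<^sup>2" for r
  proof (cases "r = 0")
    case True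
    then show ?thesis using L0[of 0] by auto
  next
    case False
    then have ne: "L r \<noteq> 0" "L (Q *v r) \<noteq> 0"
      using L0 Qinj[of r 0] by auto
    have mem: "L r \<in> X\<^sub>h" "L (Q *v r) \<in> X\<^sub>h" using LX by auto
    have "p * (norm (L r))\<^sup>2 \<le> cmod (cinner (L (Q *v r)) (L r))"
      using num_range_dist_le[OF num_range(1) mem(1) ne(1)] unfolding op p_def .
    moreover have "q * (norm (L (Q *v r)))\<^sup>2 \<le> cmod (cinner (L r) (L (Q *v r)))"
      using num_range_dist_le[OF num_range(2) mem(2) ne(2)] unfolding inv_op q_def .
    ultimately obtain \<alpha> where
      "(norm (L r - \<alpha> *\<^sub>C L (Q *v r)))\<^sup>2 \<le> (1 - p * q) * (norm (L r))\<^sup>2"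
      using minimal_residual_step[OF ne(2) pq0(1) _ pq0(2)] by blast
    also have "\<dots> \<le> (1 - 1 / K) * (norm (L r))\<^sup>2"
      using K_le by (intro mult_right_mono) auto
    finally show ?thesis
      by (auto simp: L_def synthesis_diff synthesis_scale)
  qed
  have res: "P *v (f - A *v z) = P *v f - Q *v z" for z
    by (simp add: Q_def matrix_vector_mult_diff_distrib matrix_vector_mul_assoc)
  have r0: "P *v f - Q *v x0 \<noteq> 0" using initial by (simp add: Q_def)
  then have "0 < (norm (L (P *v f - Q *v x0)))\<^sup>2" using L0 by simp
  \<comment> \<open>The sign of \<open>1 - 1 / K\<close> is read off the one-step bound at the
    nonzero initial residual: a square lies below \<open>1 - 1 / K\<close> times a positive
    number.\<close>
  moreover have "0 \<le> (1 - 1 / K) * (norm (L (P *v f - Q *v x0)))\<^sup>2"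
    using step_sq by (meson order_trans zero_le_power2)
  ultimately have K1: "0 \<le> 1 - 1 / K" by (simp add: zero_le_mult_iff)
  then have \<rho>: "0 \<le> \<rho>" by (simp add: \<rho>_def)
  have step: "\<exists>\<alpha>. norm (L (r - \<alpha> *s (Q *v r))) \<le> \<rho> * norm (L r)" for r
    using step_sq[of r] real_sqrt_le_mono by (fastforce simp: \<rho>_def real_sqrt_mult)

  \<comment> \<open>Convergence in the weighted and in the Euclidean norm\<close>
  have "weighted_norm H = (\<lambda>u. norm (L u))"
    by (simp add: H L_def weighted_norm_gram fun_eq_iff)
  note weighted' = weighted[folded Q_def, unfolded this] and wn = this
  \<comment> \<open>Here the minimized norm and the norm of the one-step bound coincide, so both
    equivalence constants are 1.\<close>
  have "norm (L (P *v f - Q *v x k)) \<le> (1 / 1 * \<rho>) ^ k * norm (L (P *v f - Q *v x0))"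
    by (rule gmres_reduction[OF \<rho> step _ _ _ _ _ weighted' kl(3)]) auto
  then have "root k (weighted_norm H (P *v (f - A *v x k)) / weighted_norm H (P *v (f - A *v x0))) \<le> \<rho>"
    unfolding res wn using r0 L0 \<rho> kl by (intro root_quotient_le) auto
  moreover note bounds = synthesis_bounds[OF bases(1), folded L_def]
  \<comment> \<open>Now the minimized norm is Euclidean; the extreme stretching factors of the
    synthesis map serve as \<open>g\<close> and \<open>G\<close>, with ratio
    \<open>K\<^sub>\<Lambda>\<close>.\<close>
  have "norm (P *v f - Q *v x' k) \<le> (K\<^sub>\<Lambda> * \<rho>) ^ k * norm (P *v f - Q *v x0)"
    unfolding K\<^sub>\<Lambda> synthesis_cond_def
    by (rule gmres_reduction[OF \<rho> step bounds norm_ge_zero euclidean[folded Q_def] kl(3)])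
  then have "root k (norm (P *v (f - A *v x' k)) / norm (P *v (f - A *v x0))) \<le> K\<^sub>\<Lambda> * \<rho>"
    unfolding res using r0 \<rho> kl bounds(1,4)
    by (intro root_quotient_le) (auto simp: K\<^sub>\<Lambda> synthesis_cond_def)
  ultimately show ?thesis by (simp add: \<rho>_def)
qed

end
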